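(* Let $n,k,m\ge 1$ and $r\ge 0$ be integers with $r<m$ and $k\le\min\{n,m-r\}$. If $n\le m$, then $$N(n,k,m;r)=(r+1)n.$$
   Context: For a nonnegative integer $s$, $[s]=\{1,\dots,s\}$. An $r\text{-ECBC}(n,k,m)$ (erasure combinatorial batch code with redundancy $r$, with at most one item read from each server) is a multifamily $\mathcal{B}=\{B_1,\dots,B_m\}$ of $m$ subsets of $[n]$ such that for each $Y\subseteq[n]$ with $|Y|\le k$ and each $J\subseteq[m]$ with $|J|\ge m-r$ there exist subsets $C_j\subseteq B_j$ ($j\in J$) with $|C_j|\le 1$ and $Y=\bigcup_{j\in J}C_j$. Its weight is $N(\mathcal{B})=|B_1|+\cdots+|B_m|$. $N(n,k,m;r)$ denotes the minimum weight of an $r\text{-ECBC}(n,k,m)$. *)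

theory Defs
  imports Main
begin

text \<open>
  A multifamily of \<open>m\<close> subsets of \<open>[n]\<close> is an indexed family \<open>B\<close>; only its values on \<open>{1..m}\<close>
  are meaningful, and equal members at different indices are distinct servers.
\<close>

definition is_ecbc :: "nat \<Rightarrow> nat \<Rightarrow> nat \<Rightarrow> nat \<Rightarrow> (nat \<Rightarrow> nat set) \<Rightarrow> bool" where
  "is_ecbc r n k m B \<longleftrightarrow>
     (\<forall>j\<in>{1..m}. B j \<subseteq> {1..n}) \<and>
     (\<forall>Y J. Y \<subseteq> {1..n} \<longrightarrow> card Y \<le> k \<longrightarrow> J \<subseteq> {1..m} \<longrightarrow> card J \<ge> m - r \<longrightarrow>
        (\<exists>C. (\<forall>j\<in>J. C j \<subseteq> B j \<and> card (C j) \<le> 1) \<and> Y = (\<Union>j\<in>J. C j)))"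

definition ecbc_weight :: "nat \<Rightarrow> (nat \<Rightarrow> nat set) \<Rightarrow> nat" where
  "ecbc_weight m B = (\<Sum>j\<in>{1..m}. card (B j))"

text \<open>
  The minimum is over all codes with the given parameters. It carries no information when there is
  no such code; by \<open>is_ecbc_full\<close> below this does not happen for \<open>k \<le> m - r\<close>.
\<close>

definition ecbc_N :: "nat \<Rightarrow> nat \<Rightarrow> nat \<Rightarrow> nat \<Rightarrow> nat" where
  "ecbc_N n k m r = (LEAST w. \<exists>B. is_ecbc r n k m B \<and> w = ecbc_weight m B)"

lemma is_ecbc_full:
  assumes "k \<le> m - r"
  shows "is_ecbc r n k m (\<lambda>_. {1..n})"
  unfolding is_ecbc_def
proof (intro conjI allI impI)
  fix Y J :: "nat set"
  assume Y: "Y \<subseteq> {1..n}" "card Y \<le> k" and J: "J \<subseteq> {1..m}" "card J \<ge> m - r"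
  have "finite Y" "finite J" "card Y \<le> card J"
    using Y J assms finite_subset by auto
  then obtain f where f: "f ` Y \<subseteq> J" "inj_on f Y"
    using card_le_inj by metis
  have "(\<forall>j\<in>J. {y \<in> Y. f y = j} \<subseteq> {1..n} \<and> card {y \<in> Y. f y = j} \<le> 1) \<and>
        Y = (\<Union>j\<in>J. {y \<in> Y. f y = j})"
  proof (intro conjI ballI)
    fix j
    show "{y \<in> Y. f y = j} \<subseteq> {1..n}" using Y by auto
    have "\<And>x y. x \<in> {y \<in> Y. f y = j} \<Longrightarrow> y \<in> {y \<in> Y. f y = j} \<Longrightarrow> x = y"
      using f(2) by (auto dest: inj_onD)
    then show "card {y \<in> Y. f y = j} \<le> 1"
      using \<open>finite Y\<close> by (simp add: card_le_Suc0_iff_eq)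
  qed (use f in auto)
  then show "\<exists>C. (\<forall>j\<in>J. C j \<subseteq> {1..n} \<and> card (C j) \<le> 1) \<and> Y = (\<Union>j\<in>J. C j)"
    by (intro exI[of _ "\<lambda>j. {y \<in> Y. f y = j}"])
qed auto

lemma ecbc_N_attained:
  assumes "k \<le> m - r"
  shows "\<exists>B. is_ecbc r n k m B \<and> ecbc_N n k m r = ecbc_weight m B"
  unfolding ecbc_N_def
  by (rule LeastI_ex) (use is_ecbc_full[OF assms] in blast)

lemma ecbc_N_le: "is_ecbc r n k m B \<Longrightarrow> ecbc_N n k m r \<le> ecbc_weight m B"
  unfolding ecbc_N_def by (rule Least_le) blast

end

theory Submission
  imports Defs
begin

text \<open>
  Both bounds come from counting, for each item, the servers that hold it; the weight is the sum of
  these numbers (\<open>ecbc_weight_eq_sum_copies\<close>).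

  Lower bound: an item on at most \<open>r\<close> servers is lost when exactly these servers fail, so even the
  request for this single item (here \<open>1 \<le> k\<close> enters) cannot be served. Hence every item has at
  least \<open>r + 1\<close> copies.

  Upper bound: arrange the \<open>m\<close> servers in a circle and, since \<open>n \<le> m\<close>, let each item have a server of
  its own as home. Store item \<open>i\<close> on server \<open>i\<close> and on the \<open>r\<close> servers that follow it. The servers
  reachable from a nonempty set \<open>S\<close> of homes by at most \<open>t\<close> steps increase strictly with \<open>t\<close> until
  they fill the circle, because no proper nonempty set of servers is closed under the step
  (\<open>card_UN_orbit_upto_ge\<close>). So the items of \<open>S\<close> lie together on at least \<open>min m (|S| + r)\<close> servers, which is
  \<open>|S| + r\<close> as long as \<open>|S| \<le> k \<le> m - r\<close>. After \<open>r\<close> failures at least \<open>|S|\<close> of them survive, and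
  Hall's marriage theorem assigns to the requested items distinct surviving servers.
\<close>

section \<open>Hall's marriage theorem\<close>

text \<open>
  The argument of Halmos and Vaughan. If every proper nonempty subfamily has a spare element, any
  index may take any of its elements. Otherwise some proper nonempty subfamily \<open>S\<close> is tight; it must
  use up all of its union \<open>U\<close>, and Hall's condition for \<open>T \<union> S\<close> is exactly Hall's condition for \<open>T\<close>
  after \<open>U\<close> has been removed.
\<close>

lemma hall_marriage:
  fixes A :: "'i \<Rightarrow> 'a set"
  assumes "finite I"
    and "\<And>i. i \<in> I \<Longrightarrow> finite (A i)"
    and "\<And>S. S \<subseteq> I \<Longrightarrow> card S \<le> card (\<Union>i\<in>S. A i)"
  shows "\<exists>f. inj_on f I \<and> (\<forall>i\<in>I. f i \<in> A i)"
  using assms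
proof (induction I arbitrary: A rule: finite_psubset_induct)
  case (psubset I)
  note fin = psubset.prems(1) and hall = psubset.prems(2)
  have finU: "finite (\<Union>i\<in>S. A i)" if "S \<subseteq> I" for S
    using that fin finite_subset[OF that psubset.hyps] by blast
  consider "I = {}"
    | (slack) "I \<noteq> {}" "\<And>S. S \<subset> I \<Longrightarrow> S \<noteq> {} \<Longrightarrow> card S < card (\<Union>i\<in>S. A i)"
    | (tight) S where "S \<subset> I" "S \<noteq> {}" "card (\<Union>i\<in>S. A i) \<le> card S"
    by (meson not_le)
  then show ?case
  proof cases
    case 1
    then show ?thesis by simp
  next
    case slack
    then obtain i where i: "i \<in> I" by blast
    have "A i \<noteq> {}" using hall[of "{i}"] i by auto
    then obtain x where x: "x \<in> A i" by blast
    have "\<exists>f. inj_on f (I - {i}) \<and> (\<forall>j\<in>I - {i}. f j \<in> A j - {x})"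
    proof (rule psubset.IH)
      fix S assume S: "S \<subseteq> I - {i}"
      show "card S \<le> card (\<Union>j\<in>S. A j - {x})"
      proof (cases "S = {}")
        case False
        then have "card S < card (\<Union>j\<in>S. A j)" using slack(2)[of S] S i by blast
        moreover have "(\<Union>j\<in>S. A j - {x}) = (\<Union>j\<in>S. A j) - {x}" by blast
        ultimately show ?thesis by (auto simp: card_Diff_singleton_if)
      qed simp
    qed (use i fin in auto)
    then obtain f where "inj_on f (I - {i})" "\<forall>j\<in>I - {i}. f j \<in> A j - {x}" by blast
    then have "inj_on (f(i := x)) I \<and> (\<forall>j\<in>I. (f(i := x)) j \<in> A j)"
      using x by (auto simp: inj_on_def)
    then show ?thesis by blast
  next
    case tight
    define U where "U = (\<Union>i\<in>S. A i)"
    have "\<exists>f. inj_on f S \<and> (\<forall>i\<in>S. f i \<in> A i)"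
      using tight(1) by (intro psubset.IH hall) (auto intro: fin)
    then obtain f where f: "inj_on f S" "\<forall>i\<in>S. f i \<in> A i" by blast
    have "\<exists>g. inj_on g (I - S) \<and> (\<forall>i\<in>I - S. g i \<in> A i - U)"
    proof (rule psubset.IH)
      show "I - S \<subset> I" using tight by blast
      fix T assume T: "T \<subseteq> I - S"
      have fins: "finite T" "finite S"
        using T tight(1) psubset.hyps by (auto intro: finite_subset)
      have "card T + card S = card (T \<union> S)"
        using T fins by (subst card_Un_disjoint) auto
      also have "\<dots> \<le> card (\<Union>i\<in>T \<union> S. A i)"
        using T tight(1) by (intro hall) auto
      also have "(\<Union>i\<in>T \<union> S. A i) = (\<Union>i\<in>T. A i - U) \<union> U"
        unfolding U_def by blast
      also have "card \<dots> \<le> card (\<Union>i\<in>T. A i - U) + card U"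
        by (rule card_Un_le)
      finally show "card T \<le> card (\<Union>i\<in>T. A i - U)"
        using tight(3) unfolding U_def by linarith
    qed (use fin in auto)
    then obtain g where g: "inj_on g (I - S)" "\<forall>i\<in>I - S. g i \<in> A i - U" by blast
    have "f i \<noteq> g j" if "i \<in> S" "j \<in> I - S" for i j
      using that f(2) g(2) unfolding U_def by auto
    then have "inj_on (\<lambda>i. if i \<in> S then f i else g i) I"
      using f(1) g(1) unfolding inj_on_def by (smt (verit) DiffI)
    moreover have "\<forall>i\<in>I. (if i \<in> S then f i else g i) \<in> A i"
      using f(2) g(2) by auto
    ultimately show ?thesis
      by (intro exI[of _ "\<lambda>i. if i \<in> S then f i else g i"]) simp
  qed
qed

section \<open>The lower bound\<close>

lemma ecbc_weight_eq_sum_copies: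
  assumes "\<And>j. j \<in> {1..m} \<Longrightarrow> B j \<subseteq> {1..n}"
  shows "ecbc_weight m B = (\<Sum>i\<in>{1..n}. card {j\<in>{1..m}. i \<in> B j})"
proof -
  have "ecbc_weight m B = (\<Sum>j\<in>{1..m}. card {i\<in>{1..n}. i \<in> B j})"
    unfolding ecbc_weight_def
    by (intro sum.cong refl arg_cong[where f = card]) (use assms in blast)
  also have "\<dots> = (\<Sum>i\<in>{1..n}. card {j\<in>{1..m}. i \<in> B j})"
    using sum.swap_restrict[of "{1..m}" "{1..n}" "\<lambda>_ _. 1::nat" "\<lambda>j i. i \<in> B j"] by simp
  finally show ?thesis .
qed

lemma ecbc_copies_ge:
  assumes B: "is_ecbc r n k m B" and "1 \<le> k" and i: "i \<in> {1..n}"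
  shows "r + 1 \<le> card {j\<in>{1..m}. i \<in> B j}"
proof (rule ccontr)
  let ?F = "{j\<in>{1..m}. i \<in> B j}"
  assume "\<not> ?thesis"
  \<comment> \<open>All servers holding \<open>i\<close> may then fail at once.\<close>
  then have "m - r \<le> card ({1..m} - ?F)"
    by (subst card_Diff_subset) auto
  moreover have "{i} \<subseteq> {1..n}" "card {i} \<le> k" "{1..m} - ?F \<subseteq> {1..m}"
    using i \<open>1 \<le> k\<close> by auto
  ultimately obtain C where C: "\<forall>j\<in>{1..m} - ?F. C j \<subseteq> B j \<and> card (C j) \<le> 1"
      "{i} = (\<Union>j\<in>{1..m} - ?F. C j)"
    using B unfolding is_ecbc_def by meson
  from C(2) obtain j where "j \<in> {1..m} - ?F" "i \<in> C j" by blast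
  with C(1) show False by blast
qed

lemma ecbc_weight_ge:
  assumes B: "is_ecbc r n k m B" and "1 \<le> k"
  shows "(r + 1) * n \<le> ecbc_weight m B"
proof -
  have "(r + 1) * n = (\<Sum>i\<in>{1..n}. r + 1)" by simp
  also have "\<dots> \<le> (\<Sum>i\<in>{1..n}. card {j\<in>{1..m}. i \<in> B j})"
    using assms by (intro sum_mono ecbc_copies_ge)
  also have "\<dots> = ecbc_weight m B"
    using B by (intro ecbc_weight_eq_sum_copies[symmetric]) (auto simp: is_ecbc_def)
  finally show ?thesis .
qed

section \<open>Servers in a circle\<close>

text \<open>With residues in \<open>{0..<m}\<close> and servers in \<open>{1..m}\<close>, this is \<open>j + 1\<close> for \<open>j < m\<close> and sends \<open>m\<close> to \<open>1\<close>.\<close>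

definition cyclic_succ :: "nat \<Rightarrow> nat \<Rightarrow> nat" where
  "cyclic_succ m j = j mod m + 1"

lemma cyclic_succ_in: "j \<in> {1..m} \<Longrightarrow> cyclic_succ m j \<in> {1..m}"
  by (cases "j = m") (auto simp: cyclic_succ_def)

lemma cyclic_succ_funpow_in: "j \<in> {1..m} \<Longrightarrow> (cyclic_succ m ^^ t) j \<in> {1..m}"
  by (induction t) (simp_all only: funpow.simps id_apply comp_apply cyclic_succ_in)

lemma cyclic_succ_closed_eq_all:
  assumes A: "A \<subseteq> {1..m}" "A \<noteq> {}" and closed: "cyclic_succ m ` A \<subseteq> A"
  shows "A = {1..m}"
proof -
  have up: "y \<in> A" if "x \<in> A" "x \<le> y" "y \<le> m" for x y
    using that(2,3)
  proof (induction y rule: dec_induct)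
    case (step y)
    then have "cyclic_succ m y \<in> A" using closed by auto
    moreover have "cyclic_succ m y = Suc y" using step by (simp add: cyclic_succ_def)
    ultimately show ?case by simp
  qed (rule that(1))
  \<comment> \<open>From any element climb to \<open>m\<close>, wrap around to \<open>1\<close>, and climb again.\<close>
  have "m \<in> A" using A up by fastforce
  then have "cyclic_succ m m \<in> A" using closed by auto
  then have "1 \<in> A" by (simp add: cyclic_succ_def)
  with A(1) up show ?thesis by auto
qed

definition orbit_upto :: "nat \<Rightarrow> nat \<Rightarrow> nat \<Rightarrow> nat set" where
  "orbit_upto m r i = (\<lambda>t. (cyclic_succ m ^^ t) i) ` {..r}"

lemma orbit_upto_subset: "i \<in> {1..m} \<Longrightarrow> orbit_upto m r i \<subseteq> {1..m}"
  using cyclic_succ_funpow_in unfolding orbit_upto_def by blast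

lemma card_orbit_upto_le: "card (orbit_upto m r i) \<le> r + 1"
  unfolding orbit_upto_def using card_image_le[of "{..r}"] by simp

lemma orbit_upto_0: "orbit_upto m 0 i = {i}"
  by (simp add: orbit_upto_def)

lemma orbit_upto_Suc:
  "orbit_upto m (Suc r) i = orbit_upto m r i \<union> cyclic_succ m ` orbit_upto m r i"
proof -
  have "{..Suc r} = {..r} \<union> Suc ` {..r}"
    by (auto simp: atMost_Suc)
  then show ?thesis
    by (simp add: orbit_upto_def image_Un image_image)
qed

text \<open>
  Each further step adds a new server, since a nonempty set of servers closed under
  \<^const>\<open>cyclic_succ\<close> is the whole circle.
\<close>

lemma card_UN_orbit_upto_ge:
  assumes S: "S \<subseteq> {1..m}" "S \<noteq> {}"
  shows "min m (card S + r) \<le> card (\<Union>i\<in>S. orbit_upto m r i)"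
proof (induction r)
  case 0
  then show ?case by (simp add: orbit_upto_0)
next
  case (Suc r)
  let ?N = "\<lambda>r. \<Union>i\<in>S. orbit_upto m r i"
  have sub: "?N q \<subseteq> {1..m}" for q
    using S orbit_upto_subset by blast
  then have fin: "finite (?N q)" for q
    by (rule finite_subset) simp
  have ne: "?N r \<noteq> {}"
    using S by (auto simp: orbit_upto_def)
  have step: "?N (Suc r) = ?N r \<union> cyclic_succ m ` ?N r"
    by (auto simp: orbit_upto_Suc)
  show ?case
  proof (cases "?N (Suc r) = ?N r")
    case True
    then have "?N r = {1..m}"
      using step by (intro cyclic_succ_closed_eq_all[OF sub ne]) (metis Un_upper2)
    with True show ?thesis by simp
  next
    case False
    then have "card (?N r) < card (?N (Suc r))"
      using step by (intro psubset_card_mono[OF fin] psubsetI) (simp_all add: eq_commute)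
    with Suc.IH show ?thesis by simp
  qed
qed

section \<open>The cyclic code\<close>

definition cyclic_code :: "nat \<Rightarrow> nat \<Rightarrow> nat \<Rightarrow> nat \<Rightarrow> nat set" where
  "cyclic_code r n m j = {i\<in>{1..n}. j \<in> orbit_upto m r i}"

lemma cyclic_code_weight_le:
  assumes "n \<le> m"
  shows "ecbc_weight m (cyclic_code r n m) \<le> (r + 1) * n"
proof -
  have "ecbc_weight m (cyclic_code r n m)
      = (\<Sum>i\<in>{1..n}. card {j\<in>{1..m}. i \<in> cyclic_code r n m j})"
    by (rule ecbc_weight_eq_sum_copies) (auto simp: cyclic_code_def)
  also have "\<dots> \<le> (\<Sum>i\<in>{1..n}. r + 1)"
  proof (rule sum_mono)
    fix i assume "i \<in> {1..n}"
    then have "{j\<in>{1..m}. i \<in> cyclic_code r n m j} = orbit_upto m r i"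
      using assms orbit_upto_subset[of i m r] by (auto simp: cyclic_code_def)
    then show "card {j\<in>{1..m}. i \<in> cyclic_code r n m j} \<le> r + 1"
      by (simp only: card_orbit_upto_le)
  qed
  also have "\<dots> = (r + 1) * n" by simp
  finally show ?thesis .
qed

text \<open>
  Hall's condition holds with the copies restricted to the surviving servers: at most \<open>r\<close> servers
  fail, and these are offset by the \<open>r\<close> extra servers that every nonempty set of at most \<open>m - r\<close> homes
  reaches.
\<close>

lemma is_ecbc_cyclic_code:
  assumes "n \<le> m" "r < m" "k \<le> m - r"
  shows "is_ecbc r n k m (cyclic_code r n m)"
  unfolding is_ecbc_def
proof (intro conjI allI impI)
  show "\<forall>j\<in>{1..m}. cyclic_code r n m j \<subseteq> {1..n}"
    by (auto simp: cyclic_code_def)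
next
  fix Y J :: "nat set"
  assume Y: "Y \<subseteq> {1..n}" "card Y \<le> k" and J: "J \<subseteq> {1..m}" "m - r \<le> card J"
  have finY: "finite Y" using Y(1) finite_subset by blast
  have finJ: "finite J" using J(1) finite_subset by blast
  have "\<exists>f. inj_on f Y \<and> (\<forall>i\<in>Y. f i \<in> orbit_upto m r i \<inter> J)"
  proof (rule hall_marriage)
    fix S assume S: "S \<subseteq> Y"
    show "card S \<le> card (\<Union>i\<in>S. orbit_upto m r i \<inter> J)"
    proof (cases "S = {}")
      case False
      let ?N = "\<Union>i\<in>S. orbit_upto m r i"
      have Sm: "S \<subseteq> {1..m}" using S Y(1) assms(1) by fastforce
      have "card S \<le> m - r"
        using card_mono[OF finY S] Y(2) assms(3) by linarith
      then have "card S + r \<le> card ?N"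
        using card_UN_orbit_upto_ge[OF Sm False, of r] assms(2) by simp
      also have "\<dots> \<le> card (?N \<inter> J \<union> ({1..m} - J))"
        using Sm orbit_upto_subset finJ by (intro card_mono) blast+
      also have "\<dots> \<le> card (?N \<inter> J) + card ({1..m} - J)"
        by (rule card_Un_le)
      also have "card ({1..m} - J) \<le> r"
        using J finJ by (simp add: card_Diff_subset)
      finally have "card S \<le> card (?N \<inter> J)" by simp
      then show ?thesis by (simp only: Int_UN_distrib2 UN_extend_simps(4))
    qed simp
  qed (use finY finJ in auto)
  then obtain f where f: "inj_on f Y" "\<forall>i\<in>Y. f i \<in> orbit_upto m r i \<inter> J" by blast
  let ?C = "\<lambda>j. {i\<in>Y. f i = j}"
  have "card (?C j) \<le> 1" for j
    using f(1) finY by (auto simp: card_le_Suc0_iff_eq dest: inj_onD)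
  moreover have "?C j \<subseteq> cyclic_code r n m j" for j
    using f(2) Y(1) by (auto simp: cyclic_code_def)
  moreover have "Y = (\<Union>j\<in>J. ?C j)"
    using f(2) by auto
  ultimately show "\<exists>C. (\<forall>j\<in>J. C j \<subseteq> cyclic_code r n m j \<and> card (C j) \<le> 1) \<and> Y = (\<Union>j\<in>J. C j)"
    by (intro exI[of _ ?C]) blast
qed

section \<open>The minimum weight\<close>

theorem theorem8:
  fixes n k m r :: nat
  assumes "n \<ge> 1" and "k \<ge> 1" and "m \<ge> 1"
    and "r < m" and "k \<le> min n (m - r)"
    and "n \<le> m"
  shows "ecbc_N n k m r = (r + 1) * n"
proof (rule antisym)
  have "ecbc_N n k m r \<le> ecbc_weight m (cyclic_code r n m)"
    using assms by (intro ecbc_N_le is_ecbc_cyclic_code) auto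
  also have "\<dots> \<le> (r + 1) * n"
    using assms by (intro cyclic_code_weight_le)
  finally show "ecbc_N n k m r \<le> (r + 1) * n" .
next
  have "k \<le> m - r" using assms by simp
  then obtain B where "is_ecbc r n k m B" "ecbc_N n k m r = ecbc_weight m B"
    using ecbc_N_attained by blast
  then show "(r + 1) * n \<le> ecbc_N n k m r"
    using ecbc_weight_ge assms by simp
qed

end
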